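(* Let $f:\mathbf{B}_n\to\mathbf{B}_N$ and $g:\mathbf{B}_n\to\mathbf{B}_K$ be proper holomorphic maps. Then $f$ and $g$ are homotopic in target dimension $M$ whenever $M\ge n+\max(N,K)$. Furthermore, if $f$ and $g$ are rational, then the same conclusion holds with homotopy replaced by homotopy through rational maps.
   Context: $\mathbf{B}_n$ denotes the open unit ball in $\mathbf{C}^n$. A holomorphic map between balls is proper if inverse images of compact sets are compact. $u\oplus 0=(u,0)$ denotes padding by zero components. The maps $f$ and $g$ are homotopic in target dimension $M$ if there is a continuous function $H:\mathbf{B}_n\times[0,1]\to\mathbf{C}^M$, holomorphic in the first variable, such that for each $t\in[0,1]$ the map $H_t(z)=H(z,t)$ is a proper holomorphic map from $\mathbf{B}_n$ to $\mathbf{B}_M$, and $H_0\sim f\oplus 0$, $H_1\sim g\oplus 0$, where $\sim$ is norm equivalence: $u\sim v$ means $\|u(z)\|^2=\|v(z)\|^2$ for all $z$. The homotopy is through rational maps if moreover each $H_t$ is a rational mapping. *)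

theory Defs
  imports "HOL-Analysis.Analysis"
begin

text \<open>
  \<open>C\<^sup>n\<close> is \<open>complex^'n\<close> with \<open>n = CARD('n)\<close> (so \<open>n \<ge> 1\<close>); its library norm is the Hermitian
  norm, so the open unit ball \<open>B\<^sub>n\<close> is \<open>ball 0 1\<close>. A map defined on \<open>B\<^sub>n\<close> is a total function of
  which only the values on \<open>ball 0 1\<close> matter.
\<close>

text \<open>
  \<open>has_derivative\<close> gives a real-linear map; asking it to commute with complex scalars
  makes it complex-linear.
\<close>

definition holomorphic_map_on ::
    "(complex^'n::finite \<Rightarrow> complex^'m::finite) \<Rightarrow> (complex^'n) set \<Rightarrow> bool"
  where "holomorphic_map_on f S \<longleftrightarrow>
    (\<forall>z\<in>S. \<exists>D. (f has_derivative D) (at z) \<and> (\<forall>c v. D (c *s v) = c *s D v))"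

definition proper_holomorphic :: "(complex^'n::finite \<Rightarrow> complex^'m::finite) \<Rightarrow> bool"
  where "proper_holomorphic f \<longleftrightarrow>
    holomorphic_map_on f (ball 0 1) \<and>
    f ` ball 0 1 \<subseteq> ball 0 1 \<and>
    (\<forall>C. C \<subseteq> ball 0 1 \<and> compact C \<longrightarrow> compact {z \<in> ball 0 1. f z \<in> C})"

definition complex_polynomial :: "(complex^'n::finite \<Rightarrow> complex) \<Rightarrow> bool"
  where "complex_polynomial p \<longleftrightarrow>
    (\<exists>A :: ('n \<Rightarrow> nat) set. \<exists>c :: ('n \<Rightarrow> nat) \<Rightarrow> complex. finite A \<and>
      (\<forall>z. p z = (\<Sum>\<alpha>\<in>A. c \<alpha> * (\<Prod>i\<in>UNIV. (z $ i) ^ \<alpha> i))))"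

text \<open>
  Every component is, on the ball, the rational function \<open>p / q\<close>: the two agree wherever the
  nonzero polynomial \<open>q\<close> does not vanish. For continuous \<open>f\<close> this determines \<open>f\<close> on the whole ball.
\<close>

definition rational_map :: "(complex^'n::finite \<Rightarrow> complex^'m::finite) \<Rightarrow> bool"
  where "rational_map f \<longleftrightarrow>
    (\<forall>j. \<exists>p q. complex_polynomial p \<and> complex_polynomial q \<and> (\<exists>w. q w \<noteq> 0) \<and>
      (\<forall>z\<in>ball 0 1. q z \<noteq> 0 \<longrightarrow> f z $ j = p z / q z))"

text \<open>
  A fixed enumeration of each finite index type by \<open>0, \<dots>, CARD('a) - 1\<close>, so that \<open>pad u\<close> is the
  vector \<open>(u, 0)\<close>; it is meant for target dimensions at least as large as the source dimension.
\<close>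

definition coord_index :: "'a::finite \<Rightarrow> nat"
  where "coord_index = (SOME h. bij_betw h (UNIV :: 'a set) {..<CARD('a)})"

definition pad :: "complex^'a::finite \<Rightarrow> complex^'m::finite"
  where "pad u = (\<chi> j. if coord_index j < CARD('a)
                      then u $ inv (coord_index :: 'a \<Rightarrow> nat) (coord_index j) else 0)"

definition norm_equivalent ::
    "(complex^'n::finite \<Rightarrow> complex^'m::finite) \<Rightarrow> (complex^'n \<Rightarrow> complex^'m) \<Rightarrow> bool"
  where "norm_equivalent u v \<longleftrightarrow> (\<forall>z\<in>ball 0 1. (norm (u z))\<^sup>2 = (norm (v z))\<^sup>2)"

definition proper_homotopy ::
    "((complex^'n::finite) \<times> real \<Rightarrow> complex^'m::finite) \<Rightarrow>
     (complex^'n \<Rightarrow> complex^'a::finite) \<Rightarrow> (complex^'n \<Rightarrow> complex^'b::finite) \<Rightarrow> bool"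
  where "proper_homotopy H f g \<longleftrightarrow>
    continuous_on (ball 0 1 \<times> {0..1}) H \<and>
    (\<forall>t\<in>{0..1}. proper_holomorphic (\<lambda>z. H (z, t))) \<and>
    norm_equivalent (\<lambda>z. H (z, 0)) (\<lambda>z. pad (f z)) \<and>
    norm_equivalent (\<lambda>z. H (z, 1)) (\<lambda>z. pad (g z))"

text \<open>The target dimension \<open>M = CARD('m)\<close> is passed as \<open>TYPE('m)\<close>.\<close>

definition homotopic_in_dim ::
    "'m::finite itself \<Rightarrow> (complex^'n::finite \<Rightarrow> complex^'a::finite) \<Rightarrow>
     (complex^'n \<Rightarrow> complex^'b::finite) \<Rightarrow> bool"
  where "homotopic_in_dim M f g \<longleftrightarrow>
    (\<exists>H :: (complex^'n) \<times> real \<Rightarrow> complex^'m. proper_homotopy H f g)"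

definition rationally_homotopic_in_dim ::
    "'m::finite itself \<Rightarrow> (complex^'n::finite \<Rightarrow> complex^'a::finite) \<Rightarrow>
     (complex^'n \<Rightarrow> complex^'b::finite) \<Rightarrow> bool"
  where "rationally_homotopic_in_dim M f g \<longleftrightarrow>
    (\<exists>H :: (complex^'n) \<times> real \<Rightarrow> complex^'m.
      proper_homotopy H f g \<and> (\<forall>t\<in>{0..1}. rational_map (\<lambda>z. H (z, t))))"

end

theory Submission
  imports Defs
begin

text \<open>
  Both maps are joined to the identity. Place \<open>z\<close> in the first \<open>n\<close> coordinates and \<open>f(z)\<close>, \<open>g(z)\<close>
  in the coordinates from \<open>n\<close> on; the map \<open>cos \<theta> f \<oplus> sin \<theta> z\<close> has squared norm
  \<open>cos\<^sup>2 \<theta> \<bar>f\<bar>\<^sup>2 + sin\<^sup>2 \<theta> \<bar>z\<bar>\<^sup>2\<close>, a convex combination of functions below \<open>1\<close> on the ball that tend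
  to \<open>1\<close> at the sphere, so it is proper. For \<open>\<theta>\<close> from \<open>0\<close> to \<open>\<pi>\<close>, with \<open>g\<close> taking over from \<open>f\<close>
  when the cosine changes sign, this runs from \<open>f\<close> through the identity to \<open>g\<close>.
\<close>

section \<open>Enumerated coordinates and padding by zeros\<close>

lemma bij_betw_coord_index: "bij_betw (coord_index :: 'a::finite \<Rightarrow> nat) UNIV {..<CARD('a)}"
  using someI_ex[OF ex_bij_betw_finite_nat[OF finite_class.finite_UNIV[where 'a = 'a]]]
  by (simp add: coord_index_def lessThan_atLeast0)

lemma coord_index_less: "coord_index (i :: 'a::finite) < CARD('a)"
  using bij_betw_coord_index by (auto simp: bij_betw_def)

lemma inv_coord_index: "inv coord_index (coord_index (i :: 'a::finite)) = i"
  using bij_betw_coord_index[where 'a = 'a] by (simp add: bij_betw_def)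

lemma coord_index_inv:
  "m < CARD('a::finite) \<Longrightarrow> coord_index (inv (coord_index :: 'a \<Rightarrow> nat) m) = m"
  using bij_betw_coord_index[where 'a = 'a] by (auto simp: bij_betw_def intro: f_inv_into_f)

text \<open>The offset \<open>k\<close> allows several vectors to be placed in disjoint blocks of
  one target space. The natural-number difference \<open>coord_index j - k\<close> is read only
  where the guard gives \<open>k \<le> coord_index j\<close>, so truncation never
  interferes.\<close>

definition pad_from :: "nat \<Rightarrow> complex^'a::finite \<Rightarrow> complex^'m::finite"
  where "pad_from k u = (\<chi> j. if k \<le> coord_index j \<and> coord_index j < k + CARD('a)
                           then u $ inv (coord_index :: 'a \<Rightarrow> nat) (coord_index j - k) else 0)"

lemma pad_eq_pad_from: "pad = pad_from 0"
  by (auto simp: fun_eq_iff pad_def pad_from_def vec_eq_iff)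

lemma pad_from_scaleC: "pad_from k (c *s u) = c *s pad_from k u"
  by (simp add: pad_from_def vec_eq_iff)

lemma bounded_linear_pad_from:
  "bounded_linear (pad_from k :: complex^'a::finite \<Rightarrow> complex^'m::finite)"
  unfolding linear_conv_bounded_linear[symmetric]
  by (rule linearI) (simp_all add: pad_from_def vec_eq_iff)

text \<open>Coordinates outside the block contribute zero, and the block is a shifted copy of the
  index type \<open>'a\<close>. The cardinality bound makes the block fit into \<open>'m\<close>, so
  that no entry of \<open>u\<close> is cut off.\<close>

lemma norm_pad_from:
  assumes "k + CARD('a) \<le> CARD('m)"
  shows "norm (pad_from k u :: complex^'m::finite) = norm (u :: complex^'a::finite)"
proof -
  let ?S = "{j :: 'm. k \<le> coord_index j \<and> coord_index j < k + CARD('a)}"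
  have "(\<Sum>j\<in>UNIV. (norm ((pad_from k u :: complex^'m) $ j))\<^sup>2)
      = (\<Sum>j\<in>?S. (norm (u $ inv (coord_index :: 'a \<Rightarrow> nat) (coord_index j - k)))\<^sup>2)"
    by (rule sum.mono_neutral_cong_right) (auto simp: pad_from_def)
  also have "\<dots> = (\<Sum>i\<in>UNIV. (norm (u $ i))\<^sup>2)"
  proof (rule sum.reindex_bij_witness[where
        i = "\<lambda>i. inv (coord_index :: 'm \<Rightarrow> nat) (k + coord_index i)" and
        j = "\<lambda>j. inv (coord_index :: 'a \<Rightarrow> nat) (coord_index j - k)"])
    fix i :: 'a
    have "k + coord_index i < CARD('m)"
      using coord_index_less[of i] assms by linarith
    then have "coord_index (inv (coord_index :: 'm \<Rightarrow> nat) (k + coord_index i)) = k + coord_index i"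
      by (rule coord_index_inv)
    then show "inv (coord_index :: 'm \<Rightarrow> nat) (k + coord_index i) \<in> ?S"
      and "inv coord_index
            (coord_index (inv (coord_index :: 'm \<Rightarrow> nat) (k + coord_index i)) - k) = i"
      using coord_index_less[of i] by (auto simp: inv_coord_index)
  next
    fix j :: 'm
    assume "j \<in> ?S"
    then show "inv coord_index (k + coord_index (inv (coord_index :: 'a \<Rightarrow> nat)
        (coord_index j - k))) = j"
      by (simp add: coord_index_inv inv_coord_index less_diff_conv2)
  qed auto
  finally show ?thesis
    by (simp add: norm_vec_def L2_set_def)
qed

lemma norm_pad: "CARD('a) \<le> CARD('m) \<Longrightarrow>
    norm (pad u :: complex^'m::finite) = norm (u :: complex^'a::finite)"
  by (simp add: pad_eq_pad_from norm_pad_from)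

text \<open>The two blocks are disjoint, so every term of the inner product has a zero
  factor.\<close>

lemma orthogonal_pad_from:
  assumes "l + CARD('b) \<le> k"
  shows "orthogonal (pad_from k (u :: complex^'a::finite)) (pad_from l (v :: complex^'b::finite))"
  using assms by (auto simp: orthogonal_def inner_vec_def pad_from_def intro!: sum.neutral)

section \<open>Closure properties of holomorphic maps\<close>

lemma holomorphic_map_on_ident: "holomorphic_map_on (\<lambda>z. z) S"
  unfolding holomorphic_map_on_def by (auto intro!: exI[of _ "\<lambda>v. v"] derivative_eq_intros)

lemma holomorphic_map_on_add:
  assumes "holomorphic_map_on f S" "holomorphic_map_on g S"
  shows "holomorphic_map_on (\<lambda>z. f z + g z) S"
  unfolding holomorphic_map_on_def
proof
  fix z assume "z \<in> S"
  then obtain D E where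
    "(f has_derivative D) (at z)" "\<forall>c v. D (c *s v) = c *s D v"
    "(g has_derivative E) (at z)" "\<forall>c v. E (c *s v) = c *s E v"
    using assms unfolding holomorphic_map_on_def by blast
  then show "\<exists>D. ((\<lambda>z. f z + g z) has_derivative D) (at z) \<and> (\<forall>c v. D (c *s v) = c *s D v)"
    by (intro exI[of _ "\<lambda>v. D v + E v"])
      (auto intro: has_derivative_add simp: vector_add_ldistrib)
qed

lemma holomorphic_map_on_linear_compose:
  assumes "holomorphic_map_on f S" "bounded_linear L" "\<And>c v. L (c *s v) = c *s L v"
  shows "holomorphic_map_on (\<lambda>z. L (f z)) S"
  unfolding holomorphic_map_on_def
proof
  fix z assume "z \<in> S"
  then obtain D where
    "(f has_derivative D) (at z)" "\<forall>c v. D (c *s v) = c *s D v"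
    using assms unfolding holomorphic_map_on_def by blast
  then show "\<exists>D. ((\<lambda>z. L (f z)) has_derivative D) (at z) \<and> (\<forall>c v. D (c *s v) = c *s D v)"
    using assms(2,3)
    by (intro exI[of _ "\<lambda>v. L (D v)"]) (auto intro: bounded_linear.has_derivative)
qed

lemma holomorphic_map_on_scaleR_pad_from:
  assumes "holomorphic_map_on f S"
  shows "holomorphic_map_on (\<lambda>z. r *\<^sub>R pad_from k (f z)) S"
proof (rule holomorphic_map_on_linear_compose[OF assms])
  show "bounded_linear (\<lambda>u. r *\<^sub>R pad_from k u)"
    by (intro bounded_linear_const_scaleR bounded_linear_pad_from)
  show "r *\<^sub>R pad_from k (c *s v) = c *s (r *\<^sub>R pad_from k v)" for c and v :: "complex^'b"
    by (simp add: pad_from_scaleC vec_eq_iff)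
qed

lemma holomorphic_map_on_imp_continuous_on:
  assumes "holomorphic_map_on f S"
  shows "continuous_on S f"
proof (rule continuous_at_imp_continuous_on, rule ballI)
  fix z assume "z \<in> S"
  with assms show "isCont f z"
    unfolding holomorphic_map_on_def by (blast dest: has_derivative_continuous)
qed

section \<open>Proper maps and convex combinations of squared norms\<close>

lemma proper_holomorphic_ident: "proper_holomorphic (\<lambda>z. z)"
  unfolding proper_holomorphic_def
proof (intro conjI allI impI)
  fix C :: "(complex^'n) set"
  assume "C \<subseteq> ball 0 1 \<and> compact C"
  moreover from this have "{z \<in> ball 0 1. z \<in> C} = C" by blast
  ultimately show "compact {z \<in> ball 0 1. z \<in> C}" by simp
qed (auto simp: holomorphic_map_on_ident)

text \<open>The norm attains its maximum on a nonempty compact set, and in the open ball this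
  maximum is below 1. Properness can then be tested by comparing norms with one radius.\<close>

lemma compact_subset_ball_bound:
  fixes C :: "'a::real_normed_vector set"
  assumes "compact C" "C \<subseteq> ball 0 1"
  obtains r where "r < 1" "C \<subseteq> cball 0 r"
proof (cases "C = {}")
  case True
  then show ?thesis using that[of 0] by simp
next
  case False
  then obtain x where "x \<in> C" "\<forall>y\<in>C. norm y \<le> norm x"
    using continuous_attains_sup[OF assms(1) False, of norm] by (auto intro: continuous_intros)
  moreover from this have "norm x < 1" using assms(2) by auto
  ultimately show ?thesis using that[of "norm x"] by (simp add: subset_iff)
qed

lemma proper_holomorphic_norm_less:
  assumes "proper_holomorphic f" "z \<in> ball 0 1"
  shows "norm (f z) < 1"
proof -
  have "f z \<in> ball 0 1" using assms unfolding proper_holomorphic_def by blast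
  then show ?thesis by simp
qed

lemma proper_holomorphic_compact:
  assumes "proper_holomorphic f" "C \<subseteq> ball 0 1" "compact C"
  shows "compact {z \<in> ball 0 1. f z \<in> C}"
  using assms unfolding proper_holomorphic_def by simp

lemma proper_holomorphic_imp_holomorphic:
  "proper_holomorphic f \<Longrightarrow> holomorphic_map_on f (ball 0 1)"
  unfolding proper_holomorphic_def by simp

text \<open>A convex combination that is at most \<open>r\<^sup>2\<close> has a member that is at
  most \<open>r\<^sup>2\<close>. Where \<open>h\<close> has norm at most \<open>r\<close>, so does
  \<open>f\<close> or \<open>g\<close>, and properness of these two confines the preimage to a
  compact set.\<close>

lemma proper_holomorphic_convex_norm:
  fixes f :: "complex^'n::finite \<Rightarrow> complex^'a::finite"
    and g :: "complex^'n \<Rightarrow> complex^'b::finite"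
    and h :: "complex^'n \<Rightarrow> complex^'m::finite"
  assumes f: "proper_holomorphic f" and g: "proper_holomorphic g"
    and h: "holomorphic_map_on h (ball 0 1)"
    and weights: "a \<ge> 0" "b \<ge> 0" "a + b = 1"
    and norm_h: "\<And>z. z \<in> ball 0 1 \<Longrightarrow>
      (norm (h z))\<^sup>2 = a * (norm (f z))\<^sup>2 + b * (norm (g z))\<^sup>2"
  shows "proper_holomorphic h"
  unfolding proper_holomorphic_def
proof (intro conjI allI impI)
  show "holomorphic_map_on h (ball 0 1)" by (rule h)
  show "h ` ball 0 1 \<subseteq> ball 0 1"
  proof (rule image_subsetI)
    fix z :: "complex^'n" assume z: "z \<in> ball 0 1"
    then have "norm (f z) < 1" "norm (g z) < 1"
      using f g by (auto dest: proper_holomorphic_norm_less)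
    then have "(norm (f z))\<^sup>2 < 1" "(norm (g z))\<^sup>2 < 1"
      by (simp_all add: abs_square_less_1)
    then have "(norm (h z))\<^sup>2 < 1"
      unfolding norm_h[OF z] by (intro convex_bound_lt weights)
    then show "h z \<in> ball 0 1" by (simp add: abs_square_less_1)
  qed
next
  fix C :: "(complex^'m) set"
  assume C: "C \<subseteq> ball 0 1 \<and> compact C"
  then obtain r where r: "r < 1" "C \<subseteq> cball 0 r"
    using compact_subset_ball_bound by blast
  define K where "K = {z \<in> ball 0 1. f z \<in> cball 0 r} \<union> {z \<in> ball 0 1. g z \<in> cball 0 r}"
  have "cball 0 r \<subseteq> (ball 0 1 :: (complex^'a) set)"
    "cball 0 r \<subseteq> (ball 0 1 :: (complex^'b) set)"
    using r(1) by auto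
  then have "compact K"
    unfolding K_def
    by (intro compact_Un proper_holomorphic_compact[OF f] proper_holomorphic_compact[OF g]
        compact_cball)
  have "K \<subseteq> ball 0 1" unfolding K_def by blast
  have "z \<in> K" if z: "z \<in> ball 0 1" "h z \<in> C" for z
  proof (rule ccontr)
    assume "z \<notin> K"
    moreover have "norm (h z) \<le> r" using r z by auto
    \<comment> \<open>The sign of \<open>r\<close> is what lets the strict inequalities against
      \<open>r\<close> be squared.\<close>
    moreover from this have "0 \<le> r" using norm_ge_zero[of "h z"] by linarith
    ultimately have "r\<^sup>2 < (norm (f z))\<^sup>2" "r\<^sup>2 < (norm (g z))\<^sup>2"
      using z(1) by (auto simp: K_def intro!: power_strict_mono)
    \<comment> \<open>The rule \<open>convex_bound_lt\<close> bounds convex combinations from above;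
      negating all terms turns it into the lower bound wanted here.\<close>
    then have "- (a * (norm (f z))\<^sup>2 + b * (norm (g z))\<^sup>2) < - r\<^sup>2"
      using convex_bound_lt[of "- (norm (f z))\<^sup>2" "- r\<^sup>2" "- (norm (g z))\<^sup>2" a b] weights by simp
    moreover have "(norm (h z))\<^sup>2 \<le> r\<^sup>2"
      using \<open>norm (h z) \<le> r\<close> by (intro power_mono) auto
    ultimately show False using norm_h[OF z(1)] by simp
  qed
  then have "{z \<in> ball 0 1. h z \<in> C} = K \<inter> h -` C"
    using \<open>K \<subseteq> ball 0 1\<close> by auto
  \<comment> \<open>Lying inside \<open>K\<close> is not enough for compactness: the preimage must
    also be closed, which follows from continuity of \<open>h\<close> on the closed set
    \<open>K\<close>.\<close>
  moreover have "compact (K \<inter> h -` C)"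
  proof -
    have "continuous_on K h"
      using holomorphic_map_on_imp_continuous_on[OF h] \<open>K \<subseteq> ball 0 1\<close> continuous_on_subset by blast
    then have "closed (K \<inter> h -` C)"
      using \<open>compact K\<close> C
      by (intro continuous_closed_preimage) (auto intro: compact_imp_closed)
    then show ?thesis
      using compact_Int_closed[OF \<open>compact K\<close>, of "K \<inter> h -` C"] by simp
  qed
  ultimately show "compact {z \<in> ball 0 1. h z \<in> C}" by simp
qed

section \<open>Polynomials and rational maps\<close>

lemma complex_polynomial_const: "complex_polynomial (\<lambda>z. c)"
  unfolding complex_polynomial_def
  by (intro exI[of _ "{\<lambda>i. 0}"] exI[of _ "\<lambda>\<alpha>. c"]) simp

lemma complex_polynomial_coord: "complex_polynomial (\<lambda>z. z $ (i :: 'n::finite))"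
proof -
  \<comment> \<open>With the Kronecker delta moved from the exponent to the factor, the product
    collapses to its single factor at \<open>i\<close>.\<close>
  have "(\<Prod>k\<in>UNIV. (z $ k) ^ (if k = i then 1 else 0))
      = (\<Prod>k\<in>UNIV. if k = i then z $ k else 1)" for z :: "complex^'n"
    by (rule prod.cong) auto
  then show ?thesis
    unfolding complex_polynomial_def
    by (intro exI[of _ "{\<lambda>k. if k = i then 1 else 0}"] exI[of _ "\<lambda>\<alpha>. 1"]) simp
qed

lemma complex_polynomial_cmult:
  assumes "complex_polynomial p"
  shows "complex_polynomial (\<lambda>z. c * p z)"
proof -
  obtain A d where "finite A" "\<forall>z. p z = (\<Sum>\<alpha>\<in>A. d \<alpha> * (\<Prod>i\<in>UNIV. (z $ i) ^ \<alpha> i))"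
    using assms unfolding complex_polynomial_def by blast
  then show ?thesis
    unfolding complex_polynomial_def
    by (intro exI[of _ A] exI[of _ "\<lambda>\<alpha>. c * d \<alpha>"]) (simp add: sum_distrib_left mult.assoc)
qed

text \<open>Scaling a coordinate changes the numerator only, so the denominator is kept. Zero
  coordinates are covered by \<open>c = 0\<close>. This suffices for the homotopy because its blocks
  are disjoint and no two rational functions are ever added.\<close>

lemma rational_map_coordwise:
  fixes f :: "complex^'n::finite \<Rightarrow> complex^'a::finite"
    and g :: "complex^'n \<Rightarrow> complex^'b::finite"
    and h :: "complex^'n \<Rightarrow> complex^'m::finite"
  assumes f: "rational_map f" and g: "rational_map g"
    and coord: "\<And>j. (\<exists>c i. \<forall>z\<in>ball 0 1. h z $ j = c * f z $ i) \<or>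
                 (\<exists>c i. \<forall>z\<in>ball 0 1. h z $ j = c * g z $ i)"
  shows "rational_map h"
proof -
  have scaled: "\<exists>p q. complex_polynomial p \<and> complex_polynomial q \<and> (\<exists>w. q w \<noteq> 0) \<and>
      (\<forall>z\<in>ball 0 1. q z \<noteq> 0 \<longrightarrow> h z $ j = p z / q z)"
    if u: "rational_map u" and eq: "\<forall>z\<in>ball 0 1. h z $ j = c * u z $ i"
    for u :: "complex^'n \<Rightarrow> complex^'e::finite" and c i j
  proof -
    obtain p q where "complex_polynomial p" "complex_polynomial q" "\<exists>w. q w \<noteq> 0"
      "\<forall>z\<in>ball 0 1. q z \<noteq> 0 \<longrightarrow> u z $ i = p z / q z"
      using u unfolding rational_map_def by meson
    with eq show ?thesis
      by (intro exI[of _ "\<lambda>z. c * p z"] exI[of _ q]) (auto intro: complex_polynomial_cmult)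
  qed
  show ?thesis
    unfolding rational_map_def
  proof
    fix j
    show "\<exists>p q. complex_polynomial p \<and> complex_polynomial q \<and> (\<exists>w. q w \<noteq> 0) \<and>
      (\<forall>z\<in>ball 0 1. q z \<noteq> 0 \<longrightarrow> h z $ j = p z / q z)"
      using coord[of j] scaled[OF f] scaled[OF g] by blast
  qed
qed

lemma rational_map_ident: "rational_map (\<lambda>z. z)"
  unfolding rational_map_def
proof
  fix j
  show "\<exists>p q. complex_polynomial p \<and> complex_polynomial q \<and> (\<exists>w. q w \<noteq> 0) \<and>
      (\<forall>z\<in>ball 0 1. q z \<noteq> 0 \<longrightarrow> z $ j = p z / q z)"
    by (intro exI[of _ "\<lambda>z. z $ j"] exI[of _ "\<lambda>z. 1"])
      (simp add: complex_polynomial_coord complex_polynomial_const)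
qed

section \<open>The rotation between a map and the identity\<close>

definition rotation :: "(complex^'n::finite \<Rightarrow> complex^'a::finite) \<Rightarrow> real \<Rightarrow> real \<Rightarrow>
    complex^'n \<Rightarrow> complex^'m::finite"
  where "rotation f c s z = c *\<^sub>R pad_from (CARD('n)) (f z) + s *\<^sub>R pad_from 0 z"

text \<open>The summands live in disjoint blocks, so Pythagoras leaves no cross term.\<close>

lemma norm_rotation:
  fixes f :: "complex^'n::finite \<Rightarrow> complex^'a::finite"
  assumes "CARD('n) + CARD('a) \<le> CARD('m)"
  shows "(norm (rotation f c s z :: complex^'m::finite))\<^sup>2
    = c\<^sup>2 * (norm (f z))\<^sup>2 + s\<^sup>2 * (norm z)\<^sup>2"
proof -
  have "orthogonal (c *\<^sub>R pad_from (CARD('n)) (f z)) (s *\<^sub>R pad_from 0 z :: complex^'m)"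
    using orthogonal_pad_from[of 0] by (auto simp: orthogonal_def)
  then show ?thesis
    using assms
    by (simp add: rotation_def norm_add_Pythagorean norm_pad_from power_mult_distrib)
qed

text \<open>The squares of \<open>c\<close> and \<open>s\<close> serve as convex weights for
  \<open>f\<close> and the identity. Only the squares matter, so \<open>c\<close> may be a cosine or
  its negative.\<close>

lemma proper_holomorphic_rotation:
  fixes f :: "complex^'n::finite \<Rightarrow> complex^'a::finite"
  assumes "CARD('n) + CARD('a) \<le> CARD('m)" "proper_holomorphic f" "c\<^sup>2 + s\<^sup>2 = 1"
  shows "proper_holomorphic (rotation f c s :: _ \<Rightarrow> complex^'m::finite)"
proof (rule proper_holomorphic_convex_norm[OF assms(2) proper_holomorphic_ident])
  show "holomorphic_map_on (rotation f c s :: _ \<Rightarrow> complex^'m) (ball 0 1)"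
    unfolding rotation_def
    by (intro holomorphic_map_on_add holomorphic_map_on_scaleR_pad_from holomorphic_map_on_ident
        proper_holomorphic_imp_holomorphic assms(2))
qed (use assms in \<open>auto intro: norm_rotation\<close>)

lemma rational_map_rotation:
  fixes f :: "complex^'n::finite \<Rightarrow> complex^'a::finite"
  assumes "rational_map f"
  shows "rational_map (rotation f c s :: _ \<Rightarrow> complex^'m::finite)"
proof (rule rational_map_coordwise[OF assms rational_map_ident])
  fix j :: 'm
  let ?i = "inv coord_index (coord_index j - CARD('n)) :: 'a"
  let ?l = "inv coord_index (coord_index j) :: 'n"
  \<comment> \<open>The last branch writes zero as a multiple of a coordinate to match the form
    required. There \<open>?l\<close> is an unspecified index, harmless under the coefficient
    0.\<close>
  have "(rotation f c s z :: complex^'m) $ j =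
      (if coord_index j < CARD('n) then of_real s * z $ ?l
       else if coord_index j < CARD('n) + CARD('a) then of_real c * f z $ ?i
       else 0 * z $ ?l)" for z
    by (simp add: rotation_def pad_from_def scaleR_conv_of_real[where 'a = complex])
  then show "(\<exists>d i. \<forall>z\<in>ball 0 1. (rotation f c s z :: complex^'m) $ j = d * f z $ i) \<or>
      (\<exists>d i. \<forall>z\<in>ball 0 1. (rotation f c s z :: complex^'m) $ j = d * z $ i)"
    by (cases "coord_index j < CARD('n)"; cases "coord_index j < CARD('n) + CARD('a)")
      (simp; blast)+
qed

theorem proposition2p4:
  fixes f :: "complex^'n::finite \<Rightarrow> complex^'N::finite"
    and g :: "complex^'n \<Rightarrow> complex^'K::finite"
  assumes "proper_holomorphic f" and "proper_holomorphic g"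
    and "CARD('M::finite) \<ge> CARD('n) + max CARD('N) CARD('K)"
  shows "homotopic_in_dim TYPE('M) f g \<and>
    (rational_map f \<and> rational_map g \<longrightarrow> rationally_homotopic_in_dim TYPE('M) f g)"
proof -
  have card: "CARD('n) + CARD('N) \<le> CARD('M)" "CARD('n) + CARD('K) \<le> CARD('M)"
    using assms(3) by auto
  \<comment> \<open>The positive and negative parts of the cosine are never both nonzero, so
    \<open>f\<close> and \<open>g\<close> can share the block starting at \<open>CARD('n)\<close>
    without interacting. Having \<open>z\<close> come first keeps its place independent of
    \<open>'N\<close> and \<open>'K\<close>. A single formula with \<open>max\<close> makes joint
    continuity immediate, also at \<open>t = 1/2\<close>.\<close>
  define H :: "(complex^'n) \<times> real \<Rightarrow> complex^'M" where
    "H = (\<lambda>(z, t). max (cos (pi * t)) 0 *\<^sub>R pad_from (CARD('n)) (f z) +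
                   max (- cos (pi * t)) 0 *\<^sub>R pad_from (CARD('n)) (g z) +
                   sin (pi * t) *\<^sub>R pad_from 0 z)"
  \<comment> \<open>For fixed \<open>t\<close> the map is one rotation, which reduces properness and
    rationality to the lemmas above. At cosine zero both descriptions agree, as only the
    \<open>z\<close> block remains.\<close>
  have H_cases: "(\<lambda>z. H (z, t)) = (if cos (pi * t) \<ge> 0
      then rotation f (cos (pi * t)) (sin (pi * t))
      else rotation g (- cos (pi * t)) (sin (pi * t)))" for t
    by (auto simp: H_def rotation_def fun_eq_iff max_def)
  have proper: "proper_holomorphic (\<lambda>z. H (z, t))" for t
    using proper_holomorphic_rotation[OF card(1) assms(1)]
      proper_holomorphic_rotation[OF card(2) assms(2)]
    by (simp add: H_cases)
  have "continuous_on (ball 0 1 \<times> {0..1}) H"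
  proof -
    have "continuous_on (ball 0 1) f" "continuous_on (ball 0 1) g"
      using assms(1,2)
      by (simp_all add: proper_holomorphic_imp_holomorphic holomorphic_map_on_imp_continuous_on)
    then have "continuous_on (ball 0 1 \<times> {0..1}) (\<lambda>x :: (complex^'n) \<times> real. f (fst x))"
      "continuous_on (ball 0 1 \<times> {0..1}) (\<lambda>x :: (complex^'n) \<times> real. g (fst x))"
      by (auto intro!: continuous_on_compose2[of "ball 0 1" _ _ fst] continuous_intros)
    then show ?thesis
      unfolding H_def case_prod_unfold
      by (intro continuous_intros bounded_linear.continuous_on[OF bounded_linear_pad_from])
  qed
  \<comment> \<open>At this endpoint \<open>f z\<close> sits in the block from
    \<open>CARD('n)\<close> on, whereas \<open>pad\<close> puts it first. The maps may differ, but
    their norms agree, which is all that norm equivalence asks.\<close>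
  moreover have "norm_equivalent (\<lambda>z. H (z, 0)) (\<lambda>z. pad (f z))"
    using card(1) norm_rotation[OF card(1), of f 1 0]
    by (auto simp: norm_equivalent_def H_cases norm_pad)
  moreover have "norm_equivalent (\<lambda>z. H (z, 1)) (\<lambda>z. pad (g z))"
    using card(2) norm_rotation[OF card(2), of g 1 0]
    by (auto simp: norm_equivalent_def H_cases norm_pad)
  ultimately have "proper_homotopy H f g"
    using proper by (simp add: proper_homotopy_def)
  moreover have "rational_map (\<lambda>z. H (z, t))" if "rational_map f" "rational_map g" for t
    using that by (simp add: H_cases rational_map_rotation)
  ultimately show ?thesis
    unfolding homotopic_in_dim_def rationally_homotopic_in_dim_def by blast
qed

end
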